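(* If $X$ is an E-space, then $hl(X)=c(X)=hc(X)$.
   Context: "Space" means topological $T_0$-space. $\mathbb N=\{1,2,\dots\}$. For a space $X$, a zero-set is $f^{-1}(0)$ and a cozero-set is $X\setminus f^{-1}(0)$ for a continuous $f:X\to[0,1]$; $Z(X)$ and $Coz(X)$ are the collections of all zero-sets and all cozero-sets. A U-representation of a subset $V$ of a space $X$ is a collection $U(V)=\{U_k(V): k\in\mathbb N\}$ with $V=\bigcup_k U_k(V)$ and, for all $k\in\mathbb N$, $U_k(V)\subseteq U_{k+1}(V)$, $U_{2k-1}(V)\in Z(X)$, $U_{2k}(V)\in Coz(X)$. A family $\alpha$ of subsets of $X$ is an almost subbase of $X$ if one can choose for each $V\in\alpha$ a U-representation $U(V)$ such that $\alpha\cup\{X\setminus U_{2k-1}(V): V\in\alpha, k\in\mathbb N\}$ is a subbase of $X$. A family of subsets of a set is strongly point-finite if every subfamily of cardinality $\aleph_0$ contains a finite subfamily with empty intersection; it is $\sigma$-strongly point-finite if it is a union of countably many strongly point-finite families. $X$ is an E-space if it has a $\sigma$-strongly point-finite almost subbase. Cardinal functions take infinite values: $c(X)$ (Souslin number) is the least cardinal $\tau\ge\aleph_0$ such that every disjoint family of non-empty open subsets of $X$ has cardinality $\le\tau$; $l(X)$ (Lindelöf number) is the least cardinal $\tau\ge\aleph_0$ such that every open cover of $X$ has an open refinement (covering $X$) of cardinality $\le\tau$; $hc(X)=\sup\{c(A): A\subseteq X\}$ and $hl(X)=\sup\{l(A): A\subseteq X\}$. *)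

theory Defs
  imports "HOL-Analysis.Analysis"
begin

unbundle cardinal_syntax
no_notation elt_set_eq (infix \<open>=o\<close> 50)

definition zero_set_of :: "'a topology \<Rightarrow> 'a set \<Rightarrow> bool" where
  "zero_set_of X Z \<longleftrightarrow>
     (\<exists>f. continuous_map X (top_of_set {0..1::real}) f \<and> Z = {x \<in> topspace X. f x = 0})"

definition cozero_set_of :: "'a topology \<Rightarrow> 'a set \<Rightarrow> bool" where
  "cozero_set_of X W \<longleftrightarrow>
     (\<exists>f. continuous_map X (top_of_set {0..1::real}) f
          \<and> W = topspace X - {x \<in> topspace X. f x = 0})"

text \<open>The members of a U-representation are indexed by the positive integers; the value of
  \<open>U\<close> at \<open>0\<close> is irrelevant.\<close>

definition U_representation :: "'a topology \<Rightarrow> 'a set \<Rightarrow> (nat \<Rightarrow> 'a set) \<Rightarrow> bool" where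
  "U_representation X V U \<longleftrightarrow>
     V = (\<Union>k\<in>{1..}. U k) \<and>
     (\<forall>k\<ge>1. U k \<subseteq> U (k + 1) \<and> zero_set_of X (U (2 * k - 1)) \<and> cozero_set_of X (U (2 * k)))"

text \<open>The intersection of the empty subfamily is read as the whole space.\<close>

definition subbase_of :: "'a topology \<Rightarrow> 'a set set \<Rightarrow> bool" where
  "subbase_of X \<B> \<longleftrightarrow>
     (\<forall>B\<in>\<B>. openin X B) \<and>
     X = topology (arbitrary union_of
           (finite intersection_of (\<lambda>B. B \<in> \<B>) relative_to topspace X))"

definition almost_subbase_of :: "'a topology \<Rightarrow> 'a set set \<Rightarrow> bool" where
  "almost_subbase_of X \<alpha> \<longleftrightarrow>
     (\<forall>V\<in>\<alpha>. V \<subseteq> topspace X) \<and>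
     (\<exists>U. (\<forall>V\<in>\<alpha>. U_representation X V (U V)) \<and>
          subbase_of X (\<alpha> \<union> {topspace X - U V (2 * k - 1) | V k. V \<in> \<alpha> \<and> k \<ge> (1::nat)}))"

text \<open>Since \<open>\<Inter>{} = UNIV\<close> is non-empty, the subfamily \<open>\<gamma>\<close> below is necessarily non-empty.\<close>

definition strongly_point_finite :: "'a set set \<Rightarrow> bool" where
  "strongly_point_finite \<alpha> \<longleftrightarrow>
     (\<forall>\<beta>\<subseteq>\<alpha>. infinite \<beta> \<and> countable \<beta> \<longrightarrow> (\<exists>\<gamma>\<subseteq>\<beta>. finite \<gamma> \<and> \<Inter>\<gamma> = {}))"

definition sigma_strongly_point_finite :: "'a set set \<Rightarrow> bool" where
  "sigma_strongly_point_finite \<alpha> \<longleftrightarrow>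
     (\<exists>A :: nat \<Rightarrow> 'a set set. \<alpha> = (\<Union>n. A n) \<and> (\<forall>n. strongly_point_finite (A n)))"

definition E_space :: "'a topology \<Rightarrow> bool" where
  "E_space X \<longleftrightarrow> t0_space X \<and> (\<exists>\<alpha>. almost_subbase_of X \<alpha> \<and> sigma_strongly_point_finite \<alpha>)"

text \<open>Cardinals are cardinal orders up to \<open>=o\<close>. All cardinal functions below are bounded by
  \<open>max(|X|, \<aleph>\<^sub>0)\<close>, so each of their values is represented on the type \<open>'a + nat\<close>; the lemmas
  \<open>souslin_number_least\<close> etc. show that leastness also holds with respect to cardinals on
  arbitrary other types.\<close>

definition least_cardinal :: "(('a + nat) rel \<Rightarrow> bool) \<Rightarrow> ('a + nat) rel" where
  "least_cardinal P =
     (SOME r. Card_order r \<and> P r \<and> (\<forall>r'. Card_order r' \<and> P r' \<longrightarrow> r \<le>o r'))"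

definition souslin_bound :: "'a topology \<Rightarrow> 'b rel \<Rightarrow> bool" where
  "souslin_bound X r \<longleftrightarrow>
     natLeq \<le>o r \<and>
     (\<forall>\<F>. (\<forall>V\<in>\<F>. openin X V \<and> V \<noteq> {}) \<and> pairwise disjnt \<F> \<longrightarrow> |\<F>| \<le>o r)"

definition souslin_number :: "'a topology \<Rightarrow> ('a + nat) rel" where
  "souslin_number X = least_cardinal (souslin_bound X)"

definition open_cover_of :: "'a topology \<Rightarrow> 'a set set \<Rightarrow> bool" where
  "open_cover_of X \<U> \<longleftrightarrow> (\<forall>U\<in>\<U>. openin X U) \<and> \<Union>\<U> = topspace X"

definition lindelof_bound :: "'a topology \<Rightarrow> 'b rel \<Rightarrow> bool" where
  "lindelof_bound X r \<longleftrightarrow>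
     natLeq \<le>o r \<and>
     (\<forall>\<U>. open_cover_of X \<U> \<longrightarrow>
        (\<exists>\<V>. open_cover_of X \<V> \<and> (\<forall>V\<in>\<V>. \<exists>U\<in>\<U>. V \<subseteq> U) \<and> |\<V>| \<le>o r))"

definition lindelof_number :: "'a topology \<Rightarrow> ('a + nat) rel" where
  "lindelof_number X = least_cardinal (lindelof_bound X)"

definition sup_cardinal :: "('a + nat) rel set \<Rightarrow> ('a + nat) rel" where
  "sup_cardinal R = least_cardinal (\<lambda>r. \<forall>s\<in>R. s \<le>o r)"

definition hereditary_souslin_number :: "'a topology \<Rightarrow> ('a + nat) rel" where
  "hereditary_souslin_number X =
     sup_cardinal {souslin_number (subtopology X A) | A. A \<subseteq> topspace X}"

definition hereditary_lindelof_number :: "'a topology \<Rightarrow> ('a + nat) rel" where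
  "hereditary_lindelof_number X =
     sup_cardinal {lindelof_number (subtopology X A) | A. A \<subseteq> topspace X}"

lemma least_cardinal:
  fixes P :: "('a + nat) rel \<Rightarrow> bool"
  assumes "Card_order r0" "P r0"
  shows "Card_order (least_cardinal P)" "P (least_cardinal P)"
    and "\<And>r. Card_order r \<Longrightarrow> P r \<Longrightarrow> least_cardinal P \<le>o r"
proof -
  have "\<exists>r\<in>{r. Card_order r \<and> P r}. \<forall>r'\<in>{r. Card_order r \<and> P r}. r \<le>o r'"
    using assms by (intro exists_minim_Card_order) auto
  then have "\<exists>r. Card_order r \<and> P r \<and> (\<forall>r'. Card_order r' \<and> P r' \<longrightarrow> r \<le>o r')"
    by blast
  from someI_ex[OF this, folded least_cardinal_def]
  show "Card_order (least_cardinal P)" "P (least_cardinal P)"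
    and "\<And>r. Card_order r \<Longrightarrow> P r \<Longrightarrow> least_cardinal P \<le>o r"
    by blast+
qed

lemma least_cardinal_le_other:
  fixes P :: "('a + nat) rel \<Rightarrow> bool" and r :: "'b rel"
  assumes "P |UNIV|" "Card_order r" and transfer: "\<And>s. r =o s \<Longrightarrow> P s"
  shows "least_cardinal P \<le>o r"
proof (cases "|UNIV :: ('a + nat) set| \<le>o r")
  case True
  have "least_cardinal P \<le>o |UNIV :: ('a + nat) set|"
    by (rule least_cardinal(3)[where P = P, OF card_of_Card_order assms(1) card_of_Card_order assms(1)])
  then show ?thesis
    using True by (rule ordLeq_transitive)
next
  case False
  have "|Field r| =o r"
    using assms(2) by (rule card_of_Field_ordIso)
  moreover have "r \<le>o |UNIV :: ('a + nat) set|"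
    using False assms(2) ordLeq_total[OF _ card_of_Well_order, of r UNIV]
    by (auto simp: card_order_on_well_order_on)
  ultimately have "|Field r| \<le>o |UNIV :: ('a + nat) set|"
    by (rule ordIso_ordLeq_trans)
  from iffD1[OF internalize_card_of_ordLeq2 this]
  obtain B :: "('a + nat) set" where B: "|Field r| =o |B|"
    by auto
  have r: "r =o |B|"
    by (rule ordIso_transitive[OF ordIso_symmetric[OF \<open>|Field r| =o r\<close>] B])
  have "least_cardinal P \<le>o |B|"
    by (rule least_cardinal(3)[where P = P,
          OF card_of_Card_order transfer[OF r] card_of_Card_order transfer[OF r]])
  then show ?thesis
    using ordIso_symmetric[OF r] by (rule ordLeq_ordIso_trans)
qed

lemma natLeq_le_UNIV: "natLeq \<le>o |UNIV :: ('a + nat) set|"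
proof -
  have "infinite (UNIV :: ('a + nat) set)"
    by simp
  then show ?thesis
    using infinite_iff_natLeq_ordLeq[of "UNIV :: ('a + nat) set"] by simp
qed

lemma souslin_bound_cong: "souslin_bound X r \<Longrightarrow> r =o s \<Longrightarrow> souslin_bound X s"
  unfolding souslin_bound_def by (auto intro: ordLeq_ordIso_trans)

lemma lindelof_bound_cong: "lindelof_bound X r \<Longrightarrow> r =o s \<Longrightarrow> lindelof_bound X s"
proof -
  assume r: "lindelof_bound X r" and eq: "r =o s"
  show "lindelof_bound X s"
    unfolding lindelof_bound_def
  proof (intro conjI allI impI)
    show "natLeq \<le>o s"
      using r ordLeq_ordIso_trans[OF _ eq, of natLeq] unfolding lindelof_bound_def by simp
  next
    fix \<U> assume "open_cover_of X \<U>"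
    then obtain \<V> where \<V>: "open_cover_of X \<V>" "\<forall>V\<in>\<V>. \<exists>U\<in>\<U>. V \<subseteq> U" "|\<V>| \<le>o r"
      using r unfolding lindelof_bound_def by auto
    then show "\<exists>\<V>. open_cover_of X \<V> \<and> (\<forall>V\<in>\<V>. \<exists>U\<in>\<U>. V \<subseteq> U) \<and> |\<V>| \<le>o s"
      using ordLeq_ordIso_trans[OF \<V>(3) eq] by auto
  qed
qed

lemma card_of_le_points:
  fixes \<F> :: "'a set set"
  assumes "\<And>V. V \<in> \<F> \<Longrightarrow> f V \<in> V" "inj_on f \<F>"
  shows "|\<F>| \<le>o |UNIV :: ('a + nat) set|"
proof -
  have "inj_on (\<lambda>V. Inl (f V) :: 'a + nat) \<F>"
    using assms(2) by (auto simp: inj_on_def)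
  then show ?thesis
    by (rule card_of_ordLeqI) simp
qed

lemma souslin_bound_UNIV: "souslin_bound (X :: 'a topology) |UNIV :: ('a + nat) set|"
  unfolding souslin_bound_def
proof (intro conjI allI impI natLeq_le_UNIV)
  fix \<F> :: "'a set set"
  assume \<F>: "(\<forall>V\<in>\<F>. openin X V \<and> V \<noteq> {}) \<and> pairwise disjnt \<F>"
  then have f: "(SOME x. x \<in> V) \<in> V" if "V \<in> \<F>" for V
    using that by (simp add: some_in_eq)
  have "inj_on (\<lambda>V. SOME x. x \<in> V) \<F>"
  proof (rule inj_onI)
    fix V W assume "V \<in> \<F>" "W \<in> \<F>" "(SOME x. x \<in> V) = (SOME x. x \<in> W)"
    then show "V = W"
      using f \<F> unfolding pairwise_def disjnt_iff by metis
  qed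
  with f show "|\<F>| \<le>o |UNIV :: ('a + nat) set|"
    by (rule card_of_le_points)
qed

lemma lindelof_bound_UNIV: "lindelof_bound (X :: 'a topology) |UNIV :: ('a + nat) set|"
  unfolding lindelof_bound_def
proof (intro conjI allI impI natLeq_le_UNIV)
  fix \<U> :: "'a set set"
  assume \<U>: "open_cover_of X \<U>"
  then obtain g where g: "\<And>x. x \<in> topspace X \<Longrightarrow> g x \<in> \<U> \<and> x \<in> g x"
  proof -
    have "\<forall>x. \<exists>U. x \<in> topspace X \<longrightarrow> U \<in> \<U> \<and> x \<in> U"
      using \<U> unfolding open_cover_of_def by (simp add: set_eq_iff) metis
    then show ?thesis
      using that by metis
  qed
  have gX: "openin X (g x)" if "x \<in> topspace X" for x
    using g[OF that] \<U> unfolding open_cover_of_def by simp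
  have "open_cover_of X (g ` topspace X)"
    unfolding open_cover_of_def
  proof (intro conjI ballI equalityI)
    show "openin X U" if "U \<in> g ` topspace X" for U
      using that by (elim imageE) (simp only: gX)
    show "\<Union>(g ` topspace X) \<subseteq> topspace X"
      by (intro UN_least openin_subset gX)
    show "topspace X \<subseteq> \<Union>(g ` topspace X)"
      by (intro subsetI UN_I) (assumption, simp only: g)
  qed
  moreover have "\<forall>V\<in>g ` topspace X. \<exists>U\<in>\<U>. V \<subseteq> U"
  proof
    fix V assume "V \<in> g ` topspace X"
    then obtain x where "x \<in> topspace X" "V = g x"
      by (elim imageE)
    then show "\<exists>U\<in>\<U>. V \<subseteq> U"
      using g[of x] by (intro bexI[of _ V]) simp_all
  qed
  moreover have "|g ` topspace X| \<le>o |UNIV :: ('a + nat) set|"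
  proof (rule ordLeq_transitive[OF card_of_image])
    have "inj_on (Inl :: 'a \<Rightarrow> 'a + nat) (topspace X)"
      by simp
    then show "|topspace X| \<le>o |UNIV :: ('a + nat) set|"
      by (rule card_of_ordLeqI) simp
  qed
  ultimately show "\<exists>\<V>. open_cover_of X \<V> \<and> (\<forall>V\<in>\<V>. \<exists>U\<in>\<U>. V \<subseteq> U)
      \<and> |\<V>| \<le>o |UNIV :: ('a + nat) set|"
    by (intro exI conjI)
qed

lemma souslin_number:
  "Card_order (souslin_number X)" "souslin_bound X (souslin_number X)"
  unfolding souslin_number_def
  by (rule least_cardinal[where P = "souslin_bound X",
        OF card_of_Card_order souslin_bound_UNIV])+

lemma souslin_number_least:
  "Card_order r \<Longrightarrow> souslin_bound X r \<Longrightarrow> souslin_number X \<le>o r"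
  unfolding souslin_number_def
  by (rule least_cardinal_le_other[where P = "souslin_bound X", OF souslin_bound_UNIV])
    (assumption | erule souslin_bound_cong)+

lemma lindelof_number:
  "Card_order (lindelof_number X)" "lindelof_bound X (lindelof_number X)"
  unfolding lindelof_number_def
  by (rule least_cardinal[where P = "lindelof_bound X",
        OF card_of_Card_order lindelof_bound_UNIV])+

lemma lindelof_number_least:
  "Card_order r \<Longrightarrow> lindelof_bound X r \<Longrightarrow> lindelof_number X \<le>o r"
  unfolding lindelof_number_def
  by (rule least_cardinal_le_other[where P = "lindelof_bound X", OF lindelof_bound_UNIV])
    (assumption | erule lindelof_bound_cong)+

lemma sup_cardinal:
  fixes R :: "('a + nat) rel set"
  assumes "\<And>s. s \<in> R \<Longrightarrow> Card_order s"
  shows "Card_order (sup_cardinal R)" "s \<in> R \<Longrightarrow> s \<le>o sup_cardinal R"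
    and "Card_order r \<Longrightarrow> (\<And>s. s \<in> R \<Longrightarrow> s \<le>o r) \<Longrightarrow> sup_cardinal R \<le>o r"
proof -
  have *: "\<forall>s\<in>R. s \<le>o |UNIV :: ('a + nat) set|"
  proof
    fix s assume "s \<in> R"
    then have "s =o |Field s|"
      using assms by (intro ordIso_symmetric[OF card_of_Field_ordIso]) simp
    then show "s \<le>o |UNIV :: ('a + nat) set|"
      by (rule ordIso_ordLeq_trans[OF _ card_of_mono1[OF subset_UNIV]])
  qed
  note l = least_cardinal[where P = "\<lambda>r. \<forall>s\<in>R. s \<le>o r", OF card_of_Card_order *,
      folded sup_cardinal_def]
  show "Card_order (sup_cardinal R)" "s \<in> R \<Longrightarrow> s \<le>o sup_cardinal R"
    using l(1) l(2) by simp_all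
  show "sup_cardinal R \<le>o r" if "Card_order r" "\<And>s. s \<in> R \<Longrightarrow> s \<le>o r"
    unfolding sup_cardinal_def
  proof (rule least_cardinal_le_other[where P = "\<lambda>r. \<forall>s\<in>R. s \<le>o r", OF * that(1)], rule ballI)
    fix t s :: "('a + nat) rel"
    assume "r =o t" "s \<in> R"
    then show "s \<le>o t"
      by (intro ordLeq_ordIso_trans[OF that(2)])
  qed
qed

end

theory Submission
  imports Defs
begin

text \<open>The key point is that the weight of an E-space is at most its Souslin number. If a non-empty
  open set \<open>W\<close> had no non-empty open subset meeting only finitely many members of a strongly
  point-finite family of open sets, one could choose distinct members one after another so that \<open>W\<close>
  meets each of their finite intersections, a contradiction. Hence a maximal disjoint family of
  non-empty open sets each meeting only finitely many members has dense union, and it bounds the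
  size of the given family by \<open>c(X)\<close>. A \<open>\<sigma>\<close>-strongly point-finite almost subbase therefore yields a
  base of at most \<open>c(X)\<close> sets, and \<open>hl(X) \<le> c(X)\<close>. The inequalities \<open>c(X) \<le> hc(X) \<le> hl(X)\<close> hold in
  every space, since every open refinement of a disjoint open cover by non-empty sets is at least as
  large as the cover.\<close>

section \<open>Cardinal arithmetic below an infinite cardinal\<close>

lemma Cinfinite_of_natLeq_le: "Card_order r \<Longrightarrow> natLeq \<le>o r \<Longrightarrow> Cinfinite r"
  using cinfinite_mono natLeq_cinfinite by blast

lemma card_of_countable_le:
  assumes "countable A" "natLeq \<le>o r"
  shows "|A| \<le>o r"
proof -
  have "|A| \<le>o |UNIV :: nat set|"
    using assms(1) by (auto simp: countable_def intro: card_of_ordLeqI)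
  also have "|UNIV :: nat set| =o natLeq"
    by (rule card_of_nat)
  finally show ?thesis
    using assms(2) by (rule ordLeq_transitive)
qed

text \<open>Finite subsets are layered by size. Each subset of size \<open>Suc n\<close> arises by
  inserting a point of \<open>S\<close> into one of size \<open>n\<close>, so induction bounds every
  layer by \<open>r\<close>, and there are only countably many layers. This turns a bound on a
  subbase into one on the base it generates.\<close>

lemma card_of_Fpow_le:
  assumes r: "Cinfinite r" and S: "|S| \<le>o r"
  shows "|Fpow S| \<le>o r"
proof -
  have nr: "natLeq \<le>o r"
    using r by (rule natLeq_ordLeq_cinfinite)
  have step: "|{F \<in> Fpow S. card F = n}| \<le>o r" for n
  proof (induction n)
    case 0
    have "{F \<in> Fpow S. card F = 0} \<subseteq> {{}}"
      by (auto simp: Fpow_def)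
    then have "countable {F \<in> Fpow S. card F = 0}"
      by (rule countable_subset) simp
    then show ?case
      using nr by (rule card_of_countable_le)
  next
    case (Suc n)
    have "{F \<in> Fpow S. card F = Suc n} \<subseteq> (\<Union>x\<in>S. insert x ` {F \<in> Fpow S. card F = n})"
    proof
      fix F assume F: "F \<in> {F \<in> Fpow S. card F = Suc n}"
      then obtain x where x: "x \<in> F"
        by fastforce
      with F have "F - {x} \<in> {F \<in> Fpow S. card F = n}" "x \<in> S" "F = insert x (F - {x})"
        by (auto simp: Fpow_def)
      then show "F \<in> (\<Union>x\<in>S. insert x ` {F \<in> Fpow S. card F = n})"
        by blast
    qed
    moreover have "|\<Union>x\<in>S. insert x ` {F \<in> Fpow S. card F = n}| \<le>o r"
      using ordLeq_transitive[OF card_of_image Suc.IH] by (intro UNION_Cinfinite_bound[OF S _ r]) blast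
    ultimately show ?case
      using card_of_mono1 ordLeq_transitive by blast
  qed
  have "Fpow S = (\<Union>n. {F \<in> Fpow S. card F = n})"
    by auto
  moreover have "|\<Union>n. {F \<in> Fpow S. card F = n}| \<le>o r"
    by (intro UNION_Cinfinite_bound[OF card_of_countable_le[OF _ nr] _ r] ballI step) simp
  ultimately show ?thesis
    by simp
qed

section \<open>Strongly point-finite open families and disjoint families\<close>

lemma strongly_point_finite_locally_finite:
  assumes op: "\<And>V. V \<in> \<alpha> \<Longrightarrow> openin X V" and spf: "strongly_point_finite \<alpha>"
    and W: "openin X W" "W \<noteq> {}"
  obtains G where "openin X G" "G \<noteq> {}" "G \<subseteq> W" "finite {V \<in> \<alpha>. V \<inter> G \<noteq> {}}"
proof (rule ccontr)
  assume "\<not> thesis"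
  with that have bad: "infinite {V \<in> \<alpha>. V \<inter> G \<noteq> {}}" if "openin X G" "G \<noteq> {}" "G \<subseteq> W" for G
    using that by blast
  \<comment> \<open>Recording the exact size \<open>n\<close> ensures that the stages grow without
    bound; the factor \<open>W\<close> makes the empty family a valid start, as \<Inter>{} is
    \<open>UNIV\<close>.\<close>
  define P where "P n \<gamma> \<longleftrightarrow> finite \<gamma> \<and> card \<gamma> = n \<and> \<gamma> \<subseteq> \<alpha> \<and> W \<inter> \<Inter>\<gamma> \<noteq> {}" for n :: nat and \<gamma>
  have openInter: "openin X (W \<inter> \<Inter>\<gamma>)" if "finite \<gamma>" "\<gamma> \<subseteq> \<alpha>" for \<gamma>
    using that
  proof (induction \<gamma> rule: finite_induct)
    case (insert V \<gamma>)
    have "W \<inter> \<Inter>(insert V \<gamma>) = V \<inter> (W \<inter> \<Inter>\<gamma>)"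
      by auto
    with insert show ?case
      by (simp add: op openin_Int)
  qed (simp add: W)
  have "\<exists>g. \<forall>n. P n (g n) \<and> g n \<subseteq> g (Suc n)"
  proof (rule dependent_nat_choice)
    show "\<exists>\<gamma>. P 0 \<gamma>"
      using W by (intro exI[of _ "{}"]) (simp add: P_def)
  next
    fix \<gamma> n assume \<gamma>: "P n \<gamma>"
    then have "infinite {V \<in> \<alpha>. V \<inter> (W \<inter> \<Inter>\<gamma>) \<noteq> {}}"
      by (intro bad openInter) (auto simp: P_def)
    \<comment> \<open>The finite family \<gamma> cannot contain all of the infinitely many members
      that meet this open set, so a new member is available.\<close>
    then have "\<not> {V \<in> \<alpha>. V \<inter> (W \<inter> \<Inter>\<gamma>) \<noteq> {}} \<subseteq> \<gamma>"
      using \<gamma> finite_subset unfolding P_def by blast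
    then obtain V where "V \<in> \<alpha>" "V \<inter> (W \<inter> \<Inter>\<gamma>) \<noteq> {}" "V \<notin> \<gamma>"
      by blast
    with \<gamma> have "P (Suc n) (insert V \<gamma>)"
      by (auto simp: P_def)
    then show "\<exists>\<gamma>'. P (Suc n) \<gamma>' \<and> \<gamma> \<subseteq> \<gamma>'"
      by blast
  qed
  then obtain g where g: "\<And>n. P n (g n)" "\<And>n. g n \<subseteq> g (Suc n)"
    by blast
  have mono: "g m \<subseteq> g n" if "m \<le> n" for m n
    using g(2) that by (rule lift_Suc_mono_le)
  have inf: "infinite (\<Union>n. g n)"
  proof
    assume fin: "finite (\<Union>n. g n)"
    \<comment> \<open>A stage whose size is one more than that of the whole union cannot
      exist.\<close>
    have "card (g (Suc (card (\<Union>n. g n)))) \<le> card (\<Union>n. g n)"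
      using fin by (intro card_mono) auto
    then show False
      using g(1) by (simp add: P_def)
  qed
  have "countable (\<Union>n. g n)" and sub: "(\<Union>n. g n) \<subseteq> \<alpha>"
    using g(1) by (auto simp: P_def intro: countable_finite)
  then have "\<exists>\<gamma>\<subseteq>(\<Union>n. g n). finite \<gamma> \<and> \<Inter>\<gamma> = {}"
    using spf[unfolded strongly_point_finite_def, rule_format, OF sub] inf by simp
  then obtain \<gamma> where \<gamma>: "\<gamma> \<subseteq> (\<Union>n. g n)" "finite \<gamma>" "\<Inter>\<gamma> = {}"
    by blast
  \<comment> \<open>The stages form a chain, so a finite part of their union lies in a single
    stage.\<close>
  from \<gamma>(2,1) have "\<exists>n. \<gamma> \<subseteq> g n"
  proof (induction \<gamma> rule: finite_induct)
    case (insert V \<gamma>)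
    then obtain m n where "\<gamma> \<subseteq> g m" "V \<in> g n"
      by auto
    then have "insert V \<gamma> \<subseteq> g (max m n)"
      using mono[of m "max m n"] mono[of n "max m n"] by auto
    then show ?case ..
  qed simp
  then obtain n where "\<gamma> \<subseteq> g n" ..
  then have "\<Inter>(g n) \<subseteq> \<Inter>\<gamma>"
    by (rule Inter_anti_mono)
  then show False
    using \<gamma>(3) g(1)[of n] by (auto simp: P_def)
qed

text \<open>Sorting the non-empty members of \<alpha> by the sets of a maximal disjoint family \<M>
  that they meet covers them by at most \<open>r\<close> finite sets.\<close>

lemma card_of_strongly_point_finite_le:
  assumes op: "\<And>V. V \<in> \<alpha> \<Longrightarrow> openin X V" and spf: "strongly_point_finite \<alpha>"
    and r: "Card_order r" "souslin_bound X r"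
  shows "|\<alpha>| \<le>o r"
proof -
  have nr: "natLeq \<le>o r"
    using r(2) by (simp add: souslin_bound_def)
  have rC: "Cinfinite r"
    using r(1) nr by (rule Cinfinite_of_natLeq_le)
  define \<G> where "\<G> = {G. openin X G \<and> G \<noteq> {} \<and> finite {V \<in> \<alpha>. V \<inter> G \<noteq> {}}}"
  let ?\<D> = "{\<F>. \<F> \<subseteq> \<G> \<and> pairwise disjnt \<F>}"
  have "\<exists>\<M>\<in>?\<D>. \<forall>\<F>\<in>?\<D>. \<M> \<subseteq> \<F> \<longrightarrow> \<F> = \<M>"
  proof (rule subset_Zorn')
    fix \<C> assume "subset.chain ?\<D> \<C>"
    then have \<C>: "\<And>\<F>. \<F> \<in> \<C> \<Longrightarrow> \<F> \<subseteq> \<G> \<and> pairwise disjnt \<F>" "chain\<^sub>\<subseteq> \<C>"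
      by (auto simp: subset_chain_def chain_subset_def)
    then have "pairwise disjnt (\<Union>\<C>)"
      by (intro pairwise_chain_Union) auto
    with \<C>(1) show "\<Union>\<C> \<in> ?\<D>"
      by blast
  qed
  then obtain \<M> where "\<M> \<in> ?\<D>" and max: "\<forall>\<F>\<in>?\<D>. \<M> \<subseteq> \<F> \<longrightarrow> \<F> = \<M>"
    by (rule bexE)
  then have \<M>: "\<M> \<subseteq> \<G>" "pairwise disjnt \<M>"
    by simp_all
  have \<M>r: "|\<M>| \<le>o r"
    using \<M> r(2) unfolding souslin_bound_def \<G>_def by blast
  \<comment> \<open>The empty set meets no \<open>G\<close> and is added separately. Any other
    uncovered \<open>V\<close> would contain an open \<open>H\<close> that could be joined to
    \<M>.\<close>
  have "V \<in> insert {} (\<Union>G\<in>\<M>. {V \<in> \<alpha>. V \<inter> G \<noteq> {}})" if V: "V \<in> \<alpha>" for V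
  proof (rule ccontr)
    assume "\<not> ?thesis"
    then have "V \<noteq> {}" and miss: "\<And>G. G \<in> \<M> \<Longrightarrow> V \<inter> G = {}"
      using V by auto
    obtain H where H: "openin X H" "H \<noteq> {}" "H \<subseteq> V" "finite {V \<in> \<alpha>. V \<inter> H \<noteq> {}}"
      using strongly_point_finite_locally_finite[OF op spf op[OF V] \<open>V \<noteq> {}\<close>] by blast
    then have "insert H \<M> \<subseteq> \<G>"
      using \<M>(1) by (auto simp: \<G>_def)
    moreover have "pairwise disjnt (insert H \<M>)"
      using \<M>(2) miss H(3) by (auto simp: pairwise_insert disjnt_def)
    ultimately have "insert H \<M> = \<M>"
      by (intro max[rule_format]) auto
    then have "H \<in> \<M>"
      by blast
    then show False
      using miss H(2,3) by blast
  qed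
  then have "\<alpha> \<subseteq> {{}} \<union> (\<Union>G\<in>\<M>. {V \<in> \<alpha>. V \<inter> G \<noteq> {}})"
    by auto
  then have "|\<alpha>| \<le>o |{{}} \<union> (\<Union>G\<in>\<M>. {V \<in> \<alpha>. V \<inter> G \<noteq> {}})|"
    by (rule card_of_mono1)
  also have "|{{}} \<union> (\<Union>G\<in>\<M>. {V \<in> \<alpha>. V \<inter> G \<noteq> {}})| \<le>o r"
  proof (intro Un_Cinfinite_bound UNION_Cinfinite_bound ballI \<M>r rC)
    show "|{{}}| \<le>o r"
      by (intro card_of_countable_le[OF _ nr]) simp
    show "|{V \<in> \<alpha>. V \<inter> G \<noteq> {}}| \<le>o r" if "G \<in> \<M>" for G
      using \<M>(1) that by (intro card_of_countable_le[OF _ nr] countable_finite) (auto simp: \<G>_def)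
  qed
  finally show ?thesis .
qed

section \<open>Small bases and the Lindelof number of subspaces\<close>

lemma E_space_base_le_souslin:
  assumes E: "E_space X" and r: "Card_order r" "souslin_bound X r"
  obtains \<B> where "openin X = arbitrary union_of (\<lambda>B. B \<in> \<B>)" "|\<B>| \<le>o r"
proof -
  have nr: "natLeq \<le>o r"
    using r(2) by (simp add: souslin_bound_def)
  have rC: "Cinfinite r"
    using r(1) nr by (rule Cinfinite_of_natLeq_le)
  obtain \<alpha> where \<alpha>': "almost_subbase_of X \<alpha>" "sigma_strongly_point_finite \<alpha>"
    using E by (auto simp: E_space_def)
  obtain A where \<alpha>: "\<alpha> = (\<Union>n::nat. A n)" and spf: "\<And>n. strongly_point_finite (A n)"
    using \<alpha>'(2) by (auto simp: sigma_strongly_point_finite_def)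
  obtain U where sub: "subbase_of X (\<alpha> \<union> {topspace X - U V (2 * k - 1) | V k. V \<in> \<alpha> \<and> k \<ge> (1::nat)})"
    using \<alpha>'(1) by (auto simp: almost_subbase_of_def)
  define \<S> where "\<S> = \<alpha> \<union> {topspace X - U V (2 * k - 1) | V k. V \<in> \<alpha> \<and> k \<ge> (1::nat)}"
  have \<S>: "\<And>S. S \<in> \<S> \<Longrightarrow> openin X S"
    "X = topology (arbitrary union_of (finite intersection_of (\<lambda>B. B \<in> \<S>) relative_to topspace X))"
    using sub unfolding subbase_of_def \<S>_def by blast+
  have "|A n| \<le>o r" for n
    using \<S>(1) by (intro card_of_strongly_point_finite_le[OF _ spf r]) (auto simp: \<S>_def \<alpha>)
  then have \<alpha>r: "|\<alpha>| \<le>o r"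
    unfolding \<alpha> by (intro UNION_Cinfinite_bound card_of_countable_le[OF _ nr] rC) auto
  \<comment> \<open>Each \<open>V\<close> contributes only countably many complements. The range
    also admits \<open>k = 0\<close>, where \<open>2 * k - 1\<close> is \<open>0\<close>; this is
    harmless for an upper bound.\<close>
  have "\<S> \<subseteq> \<alpha> \<union> (\<Union>V\<in>\<alpha>. range (\<lambda>k. topspace X - U V (2 * k - 1)))"
    by (auto simp: \<S>_def)
  then have "|\<S>| \<le>o |\<alpha> \<union> (\<Union>V\<in>\<alpha>. range (\<lambda>k. topspace X - U V (2 * k - 1)))|"
    by (rule card_of_mono1)
  also have "|\<alpha> \<union> (\<Union>V\<in>\<alpha>. range (\<lambda>k. topspace X - U V (2 * k - 1)))| \<le>o r"
    by (intro Un_Cinfinite_bound UNION_Cinfinite_bound \<alpha>r rC ballI card_of_countable_le[OF _ nr]) simp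
  finally have "|Fpow \<S>| \<le>o r"
    by (rule card_of_Fpow_le[OF rC])
  then have "|(\<lambda>F. topspace X \<inter> \<Inter>F) ` Fpow \<S>| \<le>o r"
    by (rule ordLeq_transitive[OF card_of_image])
  \<comment> \<open>The base consists of the finite intersections of subbase members; the empty
    family contributes the whole space.\<close>
  moreover have "(finite intersection_of (\<lambda>B. B \<in> \<S>) relative_to topspace X)
      = (\<lambda>B. B \<in> (\<lambda>F. topspace X \<inter> \<Inter>F) ` Fpow \<S>)"
    by (rule ext) (auto simp: relative_to_def intersection_of_def Fpow_def image_iff)
  moreover have "openin X = arbitrary union_of (finite intersection_of (\<lambda>B. B \<in> \<S>) relative_to topspace X)"
    using openin_subbase[of "\<lambda>B. B \<in> \<S>" "topspace X"] \<S>(2) by auto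
  ultimately show thesis
    using that by simp
qed

text \<open>The traces on \<open>A\<close> of those base sets that fit into some member of the given
  cover already form a refinement covering the subspace.\<close>

lemma lindelof_bound_subtopology_of_base:
  assumes base: "openin X = arbitrary union_of (\<lambda>B. B \<in> \<B>)"
    and r: "natLeq \<le>o r" "|\<B>| \<le>o r"
  shows "lindelof_bound (subtopology X A) r"
  unfolding lindelof_bound_def
proof (intro conjI allI impI r(1))
  fix \<U> assume \<U>: "open_cover_of (subtopology X A) \<U>"
  have \<B>: "openin X B" if "B \<in> \<B>" for B
    using that base by (simp add: arbitrary_union_of_inc)
  define \<V> where "\<V> = {A \<inter> B | B. B \<in> \<B> \<and> (\<exists>U\<in>\<U>. A \<inter> B \<subseteq> U)}"
  have sub: "\<forall>V\<in>\<V>. \<exists>U\<in>\<U>. V \<subseteq> U"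
    by (auto simp: \<V>_def)
  have "\<V> \<subseteq> (\<lambda>B. A \<inter> B) ` \<B>"
    by (auto simp: \<V>_def)
  then have "|\<V>| \<le>o |(\<lambda>B. A \<inter> B) ` \<B>|"
    by (rule card_of_mono1)
  also have "|(\<lambda>B. A \<inter> B) ` \<B>| \<le>o r"
    by (rule ordLeq_transitive[OF card_of_image r(2)])
  finally have card: "|\<V>| \<le>o r" .
  have op: "\<forall>V\<in>\<V>. openin (subtopology X A) V"
    using \<B> by (auto simp: \<V>_def openin_subtopology)
  have "x \<in> \<Union>\<V>" if x: "x \<in> topspace (subtopology X A)" for x
  proof -
    obtain U where U: "U \<in> \<U>" "x \<in> U" "openin (subtopology X A) U"
      using \<U> x unfolding open_cover_of_def by blast
    then obtain T where T: "openin X T" "U = T \<inter> A"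
      by (auto simp: openin_subtopology)
    then obtain B where "B \<in> \<B>" "x \<in> B" "B \<subseteq> T"
      using base U(2) openin_topology_base_unique[of X "\<lambda>B. B \<in> \<B>"] by blast
    moreover from this have "A \<inter> B \<subseteq> U"
      using T(2) by blast
    ultimately have "A \<inter> B \<in> \<V>" "x \<in> A \<inter> B"
      using T(2) U unfolding \<V>_def by blast+
    then show ?thesis
      by blast
  qed
  then have "open_cover_of (subtopology X A) \<V>"
    unfolding open_cover_of_def using op openin_subset by fastforce
  with sub card show "\<exists>\<V>. open_cover_of (subtopology X A) \<V> \<and> (\<forall>V\<in>\<V>. \<exists>U\<in>\<U>. V \<subseteq> U) \<and> |\<V>| \<le>o r"
    by blast
qed

section \<open>Disjoint families and the hereditary Lindelof number\<close>

text \<open>The subspace \<Union>\<F> is chosen so that \<F> itself is an open cover; a refinement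
  must have its own non-empty member inside each \<open>F\<close>.\<close>

lemma card_of_disjoint_le_lindelof_bound:
  assumes \<F>: "\<And>V. V \<in> \<F> \<Longrightarrow> openin X V \<and> V \<noteq> {}" "pairwise disjnt \<F>"
    and r: "lindelof_bound (subtopology X (\<Union>\<F>)) r"
  shows "|\<F>| \<le>o r"
proof -
  have "\<Union>\<F> \<subseteq> topspace X"
    using \<F>(1) openin_subset by blast
  then have "open_cover_of (subtopology X (\<Union>\<F>)) \<F>"
    using \<F>(1) by (auto simp: open_cover_of_def openin_open_subtopology openin_Union)
  then obtain \<V> where \<V>: "open_cover_of (subtopology X (\<Union>\<F>)) \<V>"
    "\<And>V. V \<in> \<V> \<Longrightarrow> \<exists>F\<in>\<F>. V \<subseteq> F" and card: "|\<V>| \<le>o r"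
    using r unfolding lindelof_bound_def by meson
  have cover: "\<Union>\<V> = \<Union>\<F>"
    using \<V>(1) \<open>\<Union>\<F> \<subseteq> topspace X\<close> by (auto simp: open_cover_of_def)
  have "\<exists>V. V \<in> \<V> \<and> V \<noteq> {} \<and> V \<subseteq> F" if F: "F \<in> \<F>" for F
  proof -
    obtain x where x: "x \<in> F"
      using \<F>(1)[OF F] by blast
    then obtain V where V: "V \<in> \<V>" "x \<in> V"
      using cover F by blast
    then obtain F' where F': "F' \<in> \<F>" "V \<subseteq> F'"
      using \<V>(2) by blast
    \<comment> \<open>Both sets contain \<open>x\<close>, so disjointness makes them equal.\<close>
    then have "F' = F"
      using F x V \<F>(2) by (auto simp: pairwise_def disjnt_iff)
    with V F' show ?thesis
      by blast
  qed
  then obtain h where h: "\<And>F. F \<in> \<F> \<Longrightarrow> h F \<in> \<V> \<and> h F \<noteq> {} \<and> h F \<subseteq> F"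
    by metis
  have "inj_on h \<F>"
  proof (rule inj_onI)
    fix F F' assume F: "F \<in> \<F>" "F' \<in> \<F>" "h F = h F'"
    then have "\<not> disjnt F F'"
      using h[of F] h[of F'] by (auto simp: disjnt_iff)
    then show "F = F'"
      using F \<F>(2) by (auto simp: pairwise_def)
  qed
  then have "|\<F>| \<le>o |\<V>|"
    using h by (intro card_of_ordLeqI) blast+
  then show ?thesis
    using card by (rule ordLeq_transitive)
qed

lemma hereditary_souslin_number:
  fixes X :: "'a topology"
  shows "A \<subseteq> topspace X \<Longrightarrow> souslin_number (subtopology X A) \<le>o hereditary_souslin_number X"
    and "Card_order r \<Longrightarrow> (\<And>A. A \<subseteq> topspace X \<Longrightarrow> souslin_number (subtopology X A) \<le>o r)
      \<Longrightarrow> hereditary_souslin_number X \<le>o r"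
proof -
  let ?R = "{souslin_number (subtopology X A) | A. A \<subseteq> topspace X}"
  have R: "Card_order s" if "s \<in> ?R" for s
    using that souslin_number(1) by blast
  show "A \<subseteq> topspace X \<Longrightarrow> souslin_number (subtopology X A) \<le>o hereditary_souslin_number X"
    unfolding hereditary_souslin_number_def by (rule sup_cardinal(2)[OF R]) blast+
  show "hereditary_souslin_number X \<le>o r"
    if "Card_order r" "\<And>A. A \<subseteq> topspace X \<Longrightarrow> souslin_number (subtopology X A) \<le>o r"
    unfolding hereditary_souslin_number_def using that(2) by (intro sup_cardinal(3)[OF R that(1)]) blast+
qed

lemma hereditary_lindelof_number:
  fixes X :: "'a topology"
  shows "Card_order (hereditary_lindelof_number X)"
    and "A \<subseteq> topspace X \<Longrightarrow> lindelof_number (subtopology X A) \<le>o hereditary_lindelof_number X"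
    and "Card_order r \<Longrightarrow> (\<And>A. A \<subseteq> topspace X \<Longrightarrow> lindelof_number (subtopology X A) \<le>o r)
      \<Longrightarrow> hereditary_lindelof_number X \<le>o r"
proof -
  let ?R = "{lindelof_number (subtopology X A) | A. A \<subseteq> topspace X}"
  have R: "Card_order s" if "s \<in> ?R" for s
    using that lindelof_number(1) by blast
  show "Card_order (hereditary_lindelof_number X)"
    unfolding hereditary_lindelof_number_def by (rule sup_cardinal(1)[OF R])
  show "A \<subseteq> topspace X \<Longrightarrow> lindelof_number (subtopology X A) \<le>o hereditary_lindelof_number X"
    unfolding hereditary_lindelof_number_def by (rule sup_cardinal(2)[OF R]) blast+
  show "hereditary_lindelof_number X \<le>o r"
    if "Card_order r" "\<And>A. A \<subseteq> topspace X \<Longrightarrow> lindelof_number (subtopology X A) \<le>o r"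
    unfolding hereditary_lindelof_number_def using that(2) by (intro sup_cardinal(3)[OF R that(1)]) blast+
qed

lemma lindelof_bound_mono:
  assumes "lindelof_bound X r" "r \<le>o s"
  shows "lindelof_bound X s"
  using assms ordLeq_transitive unfolding lindelof_bound_def by meson

lemma hereditary_souslin_le_hereditary_lindelof:
  "hereditary_souslin_number X \<le>o hereditary_lindelof_number X"
proof (intro hereditary_souslin_number(2) souslin_number_least hereditary_lindelof_number(1))
  fix A assume A: "A \<subseteq> topspace X"
  have bound: "lindelof_bound (subtopology X B) (hereditary_lindelof_number X)" if "B \<subseteq> topspace X" for B
    using lindelof_bound_mono lindelof_number(2) hereditary_lindelof_number(2)[OF that] by blast
  show "souslin_bound (subtopology X A) (hereditary_lindelof_number X)"
    unfolding souslin_bound_def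
  proof (intro conjI allI impI)
    show "natLeq \<le>o hereditary_lindelof_number X"
      using bound[OF A] by (simp add: lindelof_bound_def)
  next
    fix \<F> assume \<F>: "(\<forall>V\<in>\<F>. openin (subtopology X A) V \<and> V \<noteq> {}) \<and> pairwise disjnt \<F>"
    then have "\<Union>\<F> \<subseteq> topspace (subtopology X A)"
      using openin_subset by blast
    then have "\<Union>\<F> \<subseteq> A" "\<Union>\<F> \<subseteq> topspace X"
      by auto
    \<comment> \<open>The union of a disjoint family open in \<open>A\<close> is, as a subspace of
      \<open>A\<close>, also a subspace of \<open>X\<close>, so the hereditary bound applies to
      it.\<close>
    then have "lindelof_bound (subtopology (subtopology X A) (\<Union>\<F>)) (hereditary_lindelof_number X)"
      using bound[of "\<Union>\<F>"] by (simp add: subtopology_subtopology Int_absorb1)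
    then show "|\<F>| \<le>o hereditary_lindelof_number X"
      using \<F> by (intro card_of_disjoint_le_lindelof_bound) auto
  qed
qed

theorem corollary3p25:
  fixes X :: "'a topology"
  assumes "E_space X"
  shows "hereditary_lindelof_number X =o souslin_number X \<and>
         souslin_number X =o hereditary_souslin_number X"
proof -
  have c_hc: "souslin_number X \<le>o hereditary_souslin_number X"
    using hereditary_souslin_number(1)[of "topspace X" X] by simp
  obtain \<B> where \<B>: "openin X = arbitrary union_of (\<lambda>B. B \<in> \<B>)" "|\<B>| \<le>o souslin_number X"
    using E_space_base_le_souslin[OF assms souslin_number] by blast
  have "natLeq \<le>o souslin_number X"
    using souslin_number(2)[of X] by (simp add: souslin_bound_def)
  then have hl_c: "hereditary_lindelof_number X \<le>o souslin_number X"
    by (intro hereditary_lindelof_number(3) souslin_number(1) lindelof_number_least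
        lindelof_bound_subtopology_of_base[OF \<B>(1) _ \<B>(2)])
  note hc_hl = hereditary_souslin_le_hereditary_lindelof[of X]
  \<comment> \<open>The circle hl \<le> c \<le> hc \<le> hl gives both equalities.\<close>
  show ?thesis
    using hl_c ordLeq_transitive[OF c_hc hc_hl] c_hc ordLeq_transitive[OF hc_hl hl_c]
    by (simp add: ordIso_iff_ordLeq)
qed

end
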